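(* Let $C_d=[-1,1]^d$ and let $u_1,u_2\in\mathbb{R}^d\setminus\{0\}$ be such that the hyperplanes $u_1^\perp$ and $u_2^\perp$ (where $u^\perp=\{x\mid\langle u,x\rangle=0\}$) contain no vertex of $C_d$. Then $C_d\cap u_1^\perp$ is combinatorially equivalent to $C_d\cap u_2^\perp$ if and only if there exists a signed permutation $\pi\in B_d$ such that $u_1^\perp$ and $\pi(u_2)^\perp$ intersect exactly the same set of edges of $C_d$.
   Context: A signed permutation of $[d]=\{1,\dots,d\}$ is a permutation $\pi$ of $\{-d,\dots,-1,1,\dots,d\}$ with $\pi(-i)=-\pi(i)$ for all $i$; $B_d$ denotes the group of signed permutations. It acts on $\mathbb{R}^d$ by $\pi(v_1,\dots,v_d)=(v_{\pi(1)},\dots,v_{\pi(d)})$, where $v_{-i}:=-v_i$. Two polytopes are combinatorially equivalent if their face lattices are isomorphic. *)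

theory Defs
  imports "HOL-Analysis.Analysis"
begin

text \<open>
  The index set \<open>[d]\<close> is a finite type \<open>'n\<close> with \<open>CARD('n) = d\<close>; \<open>Pos i\<close> and \<open>Neg i\<close> stand for the
  indices \<open>i\<close> and \<open>-i\<close>, so that \<open>'n signed\<close> plays the role of \<open>{-d,\<dots>,-1,1,\<dots>,d}\<close>.
\<close>

datatype 'n signed = Pos 'n | Neg 'n

fun neg :: "'n signed \<Rightarrow> 'n signed" where
  "neg (Pos i) = Neg i"
| "neg (Neg i) = Pos i"

definition signed_perms :: "('n signed \<Rightarrow> 'n signed) set" where
  "signed_perms = {\<pi>. bij \<pi> \<and> (\<forall>i. \<pi> (neg i) = neg (\<pi> i))}"

fun coord :: "real ^ 'n \<Rightarrow> 'n signed \<Rightarrow> real" where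
  "coord v (Pos i) = v $ i"
| "coord v (Neg i) = - (v $ i)"

definition signed_act :: "('n signed \<Rightarrow> 'n signed) \<Rightarrow> real ^ 'n \<Rightarrow> real ^ 'n" where
  "signed_act \<pi> v = (\<chi> i. coord v (\<pi> (Pos i)))"

definition cube :: "(real ^ 'n) set" where
  "cube = cbox (vec (- 1)) (vec 1)"

definition perp :: "'a::real_inner \<Rightarrow> 'a set" where
  "perp u = {x. u \<bullet> x = 0}"

definition faces :: "'a::real_vector set \<Rightarrow> 'a set set" where
  "faces P = {F. F face_of P}"

text \<open>
  Face lattices are ordered by inclusion and contain the empty face and the polytope itself;
  a lattice isomorphism is the same as an order isomorphism.
\<close>

definition combinatorially_equivalent :: "'a::real_vector set \<Rightarrow> 'b::real_vector set \<Rightarrow> bool" where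
  "combinatorially_equivalent P Q \<longleftrightarrow>
     (\<exists>f. bij_betw f (faces P) (faces Q) \<and>
          (\<forall>F\<in>faces P. \<forall>G\<in>faces P. F \<subseteq> G \<longleftrightarrow> f F \<subseteq> f G))"

definition edges_met :: "real ^ 'n \<Rightarrow> (real ^ 'n) set set" where
  "edges_met u = {e. e edge_of cube \<and> e \<inter> perp u \<noteq> {}}"

end

theory Submission
  imports Defs
begin

text \<open>
  Label the facets of the cube by signed indices. As \<open>perp u\<close> avoids the vertices, the nonempty faces of
  the section correspond, with reversed order, to the sets of labels whose cube face is met by
  \<open>perp u\<close>. These sets form a simplicial complex whose maximal simplices belong to edges
  of the cube, so the edges that are met determine the face lattice.

  Conversely, an isomorphism of face lattices is an isomorphism of these complexes, hence is induced
  by a bijection \<open>\<phi>\<close> of the labels of the facets that are met. If some facet is missed, then one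
  coordinate of \<open>u\<close> outweighs all the others and the edges met are those in that direction, so a
  transposition does the job. Otherwise \<open>\<phi>\<close> is defined on all labels, and it suffices that it is odd.
  Two facets have disjoint sections if they are opposite or if their two coordinates outweigh all the
  others (a long pair). If \<open>\<phi>\<close> sends some opposite pair to a long pair, it sends the
  four-cycle of two opposite pairs and two long pairs to another one with the roles exchanged,
  and it is odd on all other labels; central symmetry of the sections then gives a contradiction.
\<close>

section \<open>Signed labels and signed coordinates\<close>

instance signed :: (finite) finite
proof
  have "p \<in> range Pos \<union> range Neg" for p :: "'a signed"
    by (cases p) auto
  then have "(UNIV :: 'a signed set) = range Pos \<union> range Neg"
    by blast
  then show "finite (UNIV :: 'a signed set)"
    by (metis finite finite_UnI finite_imageI)
qed

lemma neg_neg [simp]: "neg (neg p) = p"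
  by (cases p) auto

lemma neg_neq [simp]: "neg p \<noteq> p" "p \<noteq> neg p"
  by (cases p; simp)+

lemma neg_eq_iff [simp]: "neg p = neg q \<longleftrightarrow> p = q"
  by (metis neg_neg)

lemma neg_eq_swap: "neg p = q \<longleftrightarrow> p = neg q"
  by (metis neg_neg)

lemma inj_neg [simp]: "inj_on neg X"
  by (simp add: inj_on_def)

lemma neg_in_image_iff [simp]: "neg p \<in> neg ` X \<longleftrightarrow> p \<in> X"
  by auto

lemma in_neg_image_iff: "p \<in> neg ` X \<longleftrightarrow> neg p \<in> X"
  by (metis neg_in_image_iff neg_neg)

lemma coord_neg [simp]: "coord v (neg p) = - coord v p"
  by (cases p) auto

lemma coord_add: "coord (x + y) p = coord x p + coord y p"
  by (cases p) auto

lemma coord_diff: "coord (x - y) p = coord x p - coord y p"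
  by (cases p) auto

lemma coord_scaleR: "coord (c *\<^sub>R x) p = c * coord x p"
  by (cases p) auto

lemma coord_eqI: "(\<And>p. coord x p = coord y p) \<Longrightarrow> x = y"
  by (metis coord.simps(1) vec_eq_iff)

lemma sum_signed:
  fixes f :: "'n::finite signed \<Rightarrow> real"
  shows "(\<Sum>p\<in>UNIV. f p) = (\<Sum>i\<in>UNIV. f (Pos i) + f (Neg i))"
proof -
  have U: "(UNIV :: 'n signed set) = range Pos \<union> range Neg"
    by (metis (no_types, opaque_lifting) UNIV_eq_I UnCI rangeI signed.exhaust)
  have "(\<Sum>p\<in>UNIV. f p) = (\<Sum>p\<in>range Pos. f p) + (\<Sum>p\<in>range Neg. f p)"
    unfolding U by (rule sum.union_disjoint) auto
  also have "\<dots> = (\<Sum>i\<in>UNIV. f (Pos i) + f (Neg i))"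
    by (simp add: sum.reindex inj_on_def sum.distrib)
  finally show ?thesis .
qed

text \<open>The two labels of a coordinate contribute the same product, since both signs flip; hence
  the factor 2. The same doubling occurs in every sum over all labels below.\<close>

lemma sum_coord_mult: "(\<Sum>p\<in>UNIV. coord u p * coord x p) = 2 * (u \<bullet> x)"
  by (simp add: sum_signed inner_vec_def sum_distrib_left)

section \<open>Coordinate weights and consistent sets of labels\<close>

definition l1 :: "real ^ 'n \<Rightarrow> real" where
  "l1 u = (\<Sum>i\<in>UNIV. \<bar>u $ i\<bar>)"

lemma sum_abs_coord: "(\<Sum>p\<in>UNIV. \<bar>coord u p\<bar>) = 2 * l1 u"
  by (simp add: sum_signed l1_def sum_distrib_left)

text \<open>These are the simplices of the boundary complex of the cross-polytope, dual to the cube;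
  they stand for the nonempty faces of the cube.\<close>

definition consistent :: "'n signed set \<Rightarrow> bool" where
  "consistent S \<longleftrightarrow> (\<forall>p\<in>S. neg p \<notin> S)"

text \<open>Both labels of every coordinate that \<open>S\<close> leaves free.\<close>

definition unsupported :: "'n signed set \<Rightarrow> 'n signed set" where
  "unsupported S = {p. p \<notin> S \<and> neg p \<notin> S}"

lemma consistent_subset: "consistent S \<Longrightarrow> T \<subseteq> S \<Longrightarrow> consistent T"
  by (auto simp: consistent_def)

lemma consistent_insert:
  assumes "consistent S" "p \<in> unsupported S"
  shows "consistent (insert p S)"
  unfolding consistent_def
proof
  fix q assume "q \<in> insert p S"
  then consider "q = p" | "q \<in> S" by blast
  then show "neg q \<notin> insert p S"
  proof cases
    case 1
    then show ?thesis using assms(2) by (simp add: unsupported_def)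
  next
    case 2
    then have "neg q \<notin> S" "neg q \<noteq> p"
      using assms by (auto simp: consistent_def unsupported_def)
    then show ?thesis by simp
  qed
qed

lemma sum_consistent_split:
  fixes f :: "'n::finite signed \<Rightarrow> real"
  assumes "consistent S"
  shows "(\<Sum>p\<in>UNIV. f p) = (\<Sum>p\<in>S. f p + f (neg p)) + (\<Sum>p\<in>unsupported S. f p)"
proof -
  have U: "UNIV = (S \<union> neg ` S) \<union> unsupported S"
    by (auto simp: unsupported_def in_neg_image_iff)
  have "(\<Sum>p\<in>UNIV. f p) = (\<Sum>p\<in>S \<union> neg ` S. f p) + (\<Sum>p\<in>unsupported S. f p)"
    unfolding U by (rule sum.union_disjoint) (auto simp: unsupported_def)
  also have "(\<Sum>p\<in>S \<union> neg ` S. f p) = (\<Sum>p\<in>S. f p) + (\<Sum>p\<in>neg ` S. f p)"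
    using assms by (intro sum.union_disjoint) (auto simp: consistent_def)
  finally show ?thesis
    by (simp add: sum.reindex sum.distrib)
qed

lemma sum_unsupported:
  assumes "consistent S"
  shows "(\<Sum>p\<in>unsupported S. \<bar>coord u p\<bar>) = 2 * (l1 u - (\<Sum>p\<in>S. \<bar>coord u p\<bar>))"
  using sum_consistent_split[OF assms, of "\<lambda>p. \<bar>coord u p\<bar>"]
  by (simp add: sum_abs_coord sum_distrib_left)

lemma sum_abs_coord_le:
  "consistent S \<Longrightarrow> (\<Sum>p\<in>S. \<bar>coord u p\<bar>) \<le> l1 u"
  using sum_unsupported[of S u] sum_nonneg[of "unsupported S" "\<lambda>p. \<bar>coord u p\<bar>"] by simp

text \<open>
  With \<open>c\<close> the center of the cube face on which all labels of \<open>S\<close> have coordinate \<open>1\<close>, the inequality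
  \<open>load u S < l1 u\<close> says that \<open>\<bar>u \<bullet> c\<bar>\<close> is less than the sum of \<open>\<bar>u $ i\<bar>\<close> over the coordinates \<open>i\<close> left
  free by \<open>S\<close>, that is, that \<open>perp u\<close> meets the relative interior of that face.
\<close>

definition load :: "real ^ 'n \<Rightarrow> 'n signed set \<Rightarrow> real" where
  "load u S = \<bar>\<Sum>p\<in>S. coord u p\<bar> + (\<Sum>p\<in>S. \<bar>coord u p\<bar>)"

definition met :: "real ^ 'n \<Rightarrow> 'n signed set set" where
  "met u = {S. consistent S \<and> load u S < l1 u}"

text \<open>The vertex hypothesis in terms of loads: equality would put a vertex of the cube on
  \<open>perp u\<close>, as \<open>genericI\<close> shows.\<close>

definition generic :: "real ^ 'n \<Rightarrow> bool" where
  "generic u \<longleftrightarrow> (\<forall>S. consistent S \<longrightarrow> load u S \<noteq> l1 u)"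

definition cface :: "'n signed set \<Rightarrow> (real ^ 'n) set" where
  "cface S = {x. (\<forall>p. coord x p \<le> 1) \<and> (\<forall>p\<in>S. coord x p = 1)}"

definition active :: "real ^ 'n \<Rightarrow> 'n signed set" where
  "active x = {p. coord x p = 1}"

section \<open>Points of the section and their active labels\<close>

lemma mem_cube_iff: "x \<in> cube \<longleftrightarrow> (\<forall>p. coord x p \<le> 1)"
proof -
  have "x \<in> cube \<longleftrightarrow> (\<forall>i. - 1 \<le> x $ i \<and> x $ i \<le> 1)"
    by (simp add: cube_def mem_box_cart)
  also have "\<dots> \<longleftrightarrow> (\<forall>p. coord x p \<le> 1)"
    by (smt (verit, best) coord.elims coord.simps)
  finally show ?thesis .
qed

lemma mem_cface_iff: "x \<in> cface S \<longleftrightarrow> x \<in> cube \<and> S \<subseteq> active x"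
  by (auto simp: cface_def mem_cube_iff active_def)

lemma abs_coord_le_1: "x \<in> cube \<Longrightarrow> \<bar>coord x p\<bar> \<le> 1"
  unfolding mem_cube_iff by (smt (verit) coord_neg)

lemma consistent_active: "consistent (active x)"
  by (auto simp: consistent_def active_def)

text \<open>In \<open>u \<bullet> x = 0\<close> the coordinates fixed by \<open>S\<close> must be
  balanced by the free ones, whose contribution is at most their total weight.\<close>

lemma load_le_if_active:
  assumes "x \<in> cube" "x \<in> perp u" "S \<subseteq> active x"
  shows "load u S \<le> l1 u"
proof -
  have S: "consistent S"
    using assms(3) consistent_active consistent_subset by blast
  have "0 = (\<Sum>p\<in>S. coord u p * coord x p + coord u (neg p) * coord x (neg p))
            + (\<Sum>p\<in>unsupported S. coord u p * coord x p)"
    using assms(2) sum_consistent_split[OF S, of "\<lambda>p. coord u p * coord x p"]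
    by (simp add: sum_coord_mult perp_def)
  also have "(\<Sum>p\<in>S. coord u p * coord x p + coord u (neg p) * coord x (neg p))
      = (\<Sum>p\<in>S. 2 * coord u p)"
    using assms(3) by (intro sum.cong) (auto simp: active_def)
  finally have "2 * \<bar>\<Sum>p\<in>S. coord u p\<bar> = \<bar>\<Sum>p\<in>unsupported S. coord u p * coord x p\<bar>"
    by (simp add: sum_distrib_left[symmetric])
  also have "\<dots> \<le> (\<Sum>p\<in>unsupported S. \<bar>coord u p\<bar>)"
    by (rule order_trans[OF sum_abs], rule sum_mono)
       (simp add: abs_mult mult_left_le abs_coord_le_1[OF assms(1)])
  finally show ?thesis
    by (simp add: sum_unsupported[OF S] load_def)
qed

lemma met_if_active:
  assumes "generic u" "x \<in> cube" "x \<in> perp u" "S \<subseteq> active x"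
  shows "S \<in> met u"
proof -
  have S: "consistent S"
    using assms(4) consistent_active consistent_subset by blast
  then show ?thesis
    using load_le_if_active[OF assms(2-4)] assms(1) by (force simp: met_def generic_def)
qed

text \<open>Each free coordinate gets absolute value \<open>\<bar>c\<bar>\<close>, with the sign for
  which it contributes exactly \<open>- c\<close> times its weight. A suitable \<open>c\<close> then
  yields an inner point of a face, a vertex, or just some point with the prescribed
  coordinates.\<close>

lemma exists_balanced_point:
  fixes u :: "real ^ 'n" and c :: real
  assumes S: "consistent S"
  obtains x where "\<And>p. p \<in> S \<Longrightarrow> coord x p = 1"
    and "\<And>p. p \<in> unsupported S \<Longrightarrow> \<bar>coord x p\<bar> = \<bar>c\<bar>"
    and "u \<bullet> x = (\<Sum>p\<in>S. coord u p) - c * (l1 u - (\<Sum>p\<in>S. \<bar>coord u p\<bar>))"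
proof -
  define x :: "real ^ 'n" where "x = (\<chi> i. if Pos i \<in> S then 1 else if Neg i \<in> S then - 1
    else if u $ i < 0 then c else - c)"
  have 1: "coord x p = 1" if "p \<in> S" for p
    using that S by (cases p) (auto simp: x_def consistent_def)
  have 2: "\<bar>coord x p\<bar> = \<bar>c\<bar> \<and> coord u p * coord x p = - c * \<bar>coord u p\<bar>"
    if "p \<in> unsupported S" for p
    using that by (cases p) (auto simp: x_def unsupported_def)
  have "2 * (u \<bullet> x) = (\<Sum>p\<in>S. coord u p * coord x p + coord u (neg p) * coord x (neg p))
            + (\<Sum>p\<in>unsupported S. coord u p * coord x p)"
    using sum_consistent_split[OF S, of "\<lambda>p. coord u p * coord x p"]
    by (simp add: sum_coord_mult)
  also have "(\<Sum>p\<in>S. coord u p * coord x p + coord u (neg p) * coord x (neg p))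
      = 2 * (\<Sum>p\<in>S. coord u p)"
    unfolding sum_distrib_left by (intro sum.cong) (auto simp: 1)
  also have "(\<Sum>p\<in>unsupported S. coord u p * coord x p) = - c * (\<Sum>p\<in>unsupported S. \<bar>coord u p\<bar>)"
    unfolding sum_distrib_left by (intro sum.cong) (auto simp: 2)
  finally have "u \<bullet> x = (\<Sum>p\<in>S. coord u p) - c * (l1 u - (\<Sum>p\<in>S. \<bar>coord u p\<bar>))"
    by (simp add: sum_unsupported[OF S] algebra_simps)
  with 1 2 show thesis
    by (intro that) auto
qed

text \<open>The fixed coordinates contribute \<open>t\<close> and the free ones weigh
  \<open>r\<close>. The choice \<open>c = t / r\<close> cancels \<open>t\<close>, and since
  \<open>\<bar>c\<bar> < 1\<close> no label outside \<open>S\<close> becomes active.\<close>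

lemma exists_active_eq:
  assumes "S \<in> met u"
  obtains x where "x \<in> cube" "x \<in> perp u" "active x = S"
proof -
  have S: "consistent S" and l: "load u S < l1 u"
    using assms by (auto simp: met_def)
  define t where "t = (\<Sum>p\<in>S. coord u p)"
  define r where "r = l1 u - (\<Sum>p\<in>S. \<bar>coord u p\<bar>)"
  have tr: "\<bar>t\<bar> < r"
    using l by (simp add: load_def t_def r_def)
  obtain x where x: "\<And>p. p \<in> S \<Longrightarrow> coord x p = 1"
    "\<And>p. p \<in> unsupported S \<Longrightarrow> \<bar>coord x p\<bar> = \<bar>t / r\<bar>"
    "u \<bullet> x = t - t / r * r"
    using exists_balanced_point[OF S, of "t / r" u, folded t_def r_def] by blast
  have "\<bar>t / r\<bar> < 1"
    using tr by (simp add: abs_divide)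
  have *: "coord x p = 1 \<and> p \<in> S \<or> coord x p < 1 \<and> p \<notin> S" for p
  proof -
    consider "p \<in> S" | "neg p \<in> S" | "p \<in> unsupported S"
      by (auto simp: unsupported_def)
    then show ?thesis
    proof cases
      case 2
      then have "p \<notin> S" "coord x p = - 1"
        using x(1)[of "neg p"] S by (auto simp: consistent_def)
      then show ?thesis by simp
    next
      case 3
      then show ?thesis
        using x(2)[of p] \<open>\<bar>t / r\<bar> < 1\<close> by (auto simp: unsupported_def)
    qed (use x in auto)
  qed
  show thesis
  proof
    show "x \<in> cube" using * unfolding mem_cube_iff by (metis less_eq_real_def)
    show "active x = S" using * unfolding active_def by fastforce
    show "x \<in> perp u" using x(3) tr by (simp add: perp_def)
  qed
qed

section \<open>Faces of the section as sets of labels\<close>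

lemma cface_face_of_cube: "cface S face_of cube"
  unfolding face_of_def
proof (intro conjI ballI impI)
  show "cface S \<subseteq> cube"
    by (auto simp: mem_cface_iff)
  show "convex (cface S)"
    unfolding convex_alt cface_def
    by (auto simp: coord_add coord_scaleR intro!: convex_bound_le) 
  fix a b x assume a: "a \<in> cube" and b: "b \<in> cube" and x: "x \<in> cface S" "x \<in> open_segment a b"
  obtain s where s: "0 < s" "s < 1" "x = (1 - s) *\<^sub>R a + s *\<^sub>R b"
    using x(2) by (auto simp: in_segment)
  \<comment> \<open>A convex combination with positive weights of two numbers at most 1 equals 1
    only if both numbers do.\<close>
  have "coord a p = 1 \<and> coord b p = 1" if "p \<in> S" for p
  proof -
    have "(1 - s) * coord a p + s * coord b p = 1"
      using x(1) that s(3) by (simp add: cface_def coord_add coord_scaleR)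
    moreover have "coord a p \<le> 1" "coord b p \<le> 1"
      using a b by (auto simp: mem_cube_iff)
    then have "(1 - s) * coord a p \<le> 1 - s" "s * coord b p \<le> s"
      using s(1,2) by auto
    ultimately have "(1 - s) * coord a p = 1 - s" "s * coord b p = s"
      by linarith+
    then show ?thesis
      using s(1,2) by simp
  qed
  then show "a \<in> cface S" "b \<in> cface S"
    using a b by (auto simp: cface_def mem_cube_iff)
qed

lemma convex_perp: "convex (perp u)"
  unfolding perp_def by (rule convex_hyperplane)

lemma cface_perp_face_of: "(cface S \<inter> perp u) face_of (cube \<inter> perp u)"
  by (rule face_of_slice[OF cface_face_of_cube convex_perp])

text \<open>Take \<open>x\<close> in the relative interior of \<open>F\<close>. The slice
  \<open>G\<close> of the cube face given by the active labels of \<open>x\<close> is a face meeting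
  that interior, so it contains \<open>F\<close>. Conversely, a segment from a point of
  \<open>G\<close> to \<open>x\<close> can be prolonged beyond \<open>x\<close> inside the section,
  so the face property of \<open>F\<close> catches its starting point.\<close>

lemma face_eq_cface:
  assumes F: "F face_of (cube \<inter> perp u)" and "F \<noteq> {}"
  obtains x where "x \<in> cube" "x \<in> perp u" "F = cface (active x) \<inter> perp u"
proof -
  have "convex F"
    using F by (rule face_of_imp_convex)
  then obtain x where x: "x \<in> rel_interior F"
    using \<open>F \<noteq> {}\<close> rel_interior_eq_empty by blast
  have "F \<subseteq> cube \<inter> perp u"
    using F by (rule face_of_imp_subset)
  then have xP: "x \<in> cube" "x \<in> perp u"
    using x rel_interior_subset by blast+
  define G where "G = cface (active x) \<inter> perp u"
  have xG: "x \<in> G"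
    using xP by (simp add: G_def mem_cface_iff)
  have "F \<subseteq> G"
    unfolding G_def
    by (rule subset_of_face_of[OF cface_perp_face_of \<open>F \<subseteq> cube \<inter> perp u\<close>])
       (use x xG in \<open>auto simp: G_def disjnt_iff\<close>)
  moreover have "G \<subseteq> F"
  proof
    fix z assume z: "z \<in> G"
    show "z \<in> F"
    proof (cases "z = x")
      case True
      then show ?thesis using x rel_interior_subset by blast
    next
      case False
      have zc: "\<bar>coord z p\<bar> \<le> 1" for p
        using z abs_coord_le_1 by (auto simp: G_def mem_cface_iff)
      \<comment> \<open>Inactive labels have positive slack at \<open>x\<close>, and there are
        finitely many of them. The factor 2 allows for the largest difference of a coordinate
        between two points of the cube.\<close>
      have "\<exists>e>0. \<forall>p\<in>-active x. 2 * e \<le> 1 - coord x p"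
      proof -
        define e where "e = Min (insert 1 ((\<lambda>p. (1 - coord x p) / 2) ` (- active x)))"
        have "0 < e"
          unfolding e_def using xP(1)
          by (subst Min_gr_iff) (auto simp: mem_cube_iff active_def less_le)
        moreover have "e \<le> (1 - coord x p) / 2" if "p \<in> - active x" for p
          unfolding e_def using that by (intro Min_le) auto
        ultimately show ?thesis
          by (intro exI[of _ e]) (auto simp: field_simps)
      qed
      then obtain e where e: "e > 0" "\<And>p. p \<notin> active x \<Longrightarrow> 2 * e \<le> 1 - coord x p"
        by auto
      \<comment> \<open>\<open>b\<close> lies on the line from \<open>z\<close> through
        \<open>x\<close>, slightly beyond \<open>x\<close>.\<close>
      define b where "b = x + e *\<^sub>R (x - z)"
      have cb: "coord b p \<le> 1 \<and> (p \<in> active x \<longrightarrow> coord b p = 1)" for p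
      proof (cases "p \<in> active x")
        case True
        then have "coord z p = 1" "coord x p = 1"
          using z by (auto simp: G_def cface_def active_def)
        then show ?thesis by (simp add: b_def coord_add coord_scaleR coord_diff)
      next
        case False
        have "e * (coord x p - coord z p) \<le> e * 2"
          using e(1) zc[of p] abs_coord_le_1[OF xP(1), of p] by (intro mult_left_mono) auto
        then show ?thesis using e(2)[OF False] False
          by (simp add: b_def coord_add coord_scaleR coord_diff)
      qed
      have "b \<in> perp u"
        using z xP(2) by (simp add: G_def perp_def b_def inner_add_right inner_diff_right)
      then have "b \<in> cube \<inter> perp u"
        using cb by (auto simp: mem_cube_iff)
      moreover have "x \<in> open_segment z b"
      proof -
        have "x = (1 - 1 / (1 + e)) *\<^sub>R z + (1 / (1 + e)) *\<^sub>R b"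
        proof -
          have "(1 + e) *\<^sub>R ((1 - 1 / (1 + e)) *\<^sub>R z + (1 / (1 + e)) *\<^sub>R b) = e *\<^sub>R z + b"
            using e(1) by (simp add: scaleR_add_right algebra_simps)
          also have "\<dots> = (1 + e) *\<^sub>R x"
            by (simp add: b_def algebra_simps)
          finally show ?thesis
            using e(1) by (metis add_pos_pos less_irrefl scaleR_cancel_left zero_less_one)
        qed
        moreover have "z \<noteq> b"
        proof
          assume "z = b"
          then have "(1 + e) *\<^sub>R (x - z) = 0"
            by (simp add: b_def algebra_simps)
          then show False using e(1) False by simp
        qed
        ultimately show ?thesis
          using e(1) by (auto simp: in_segment intro!: exI[of _ "1 / (1 + e)"])
      qed
      moreover have "x \<in> F" using x rel_interior_subset by blast
      moreover have "z \<in> cube \<inter> perp u"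
        using z by (auto simp: G_def mem_cface_iff)
      ultimately show ?thesis
        using F unfolding face_of_def by blast
    qed
  qed
  ultimately show thesis
    using xP that unfolding G_def by blast
qed

text \<open>Equality of load and \<open>l1 u\<close> means \<open>\<bar>t\<bar> = r\<close>, so a
  balanced point with \<open>c\<close> equal to 1 or -1 lies on \<open>perp u\<close>; all its
  coordinates are 1 or -1, which makes it a vertex.\<close>

lemma genericI:
  fixes u :: "real ^ 'n"
  assumes "\<And>v. v extreme_point_of (cube :: (real ^ 'n) set) \<Longrightarrow> v \<notin> perp u"
  shows "generic u"
  unfolding generic_def
proof (intro allI impI notI)
  fix S :: "'n signed set" assume S: "consistent S" and l: "load u S = l1 u"
  define t where "t = (\<Sum>p\<in>S. coord u p)"
  define r where "r = l1 u - (\<Sum>p\<in>S. \<bar>coord u p\<bar>)"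
  define c :: real where "c = (if t < 0 then - 1 else 1)"
  have "\<bar>t\<bar> = r"
    using l by (simp add: load_def t_def r_def)
  then have "t = c * r"
    by (auto simp: c_def)
  obtain x where x: "\<And>p. p \<in> S \<Longrightarrow> coord x p = 1"
    "\<And>p. p \<in> unsupported S \<Longrightarrow> \<bar>coord x p\<bar> = \<bar>c\<bar>"
    "u \<bullet> x = t - c * r"
    using exists_balanced_point[OF S, of c u, folded t_def r_def] by blast
  have x1: "\<bar>coord x p\<bar> = 1" for p
    using x(1)[of p] x(1)[of "neg p"] x(2)[of p]
    by (cases "p \<in> S"; cases "neg p \<in> S") (auto simp: unsupported_def c_def)
  have "cface (active x) = {x}"
  proof
    show "{x} \<subseteq> cface (active x)"
      using x1 by (simp add: mem_cface_iff mem_cube_iff) (metis abs_ge_self)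
    show "cface (active x) \<subseteq> {x}"
    proof
      fix y assume y: "y \<in> cface (active x)"
      have "coord y p = coord x p" for p
      proof (cases "coord x p = 1")
        case True
        then show ?thesis using y by (simp add: cface_def active_def)
      next
        case False
        then have "coord x (neg p) = 1" using x1[of p] by simp
        moreover from this have "coord y (neg p) = 1"
          using y unfolding cface_def active_def by blast
        ultimately show ?thesis by simp
      qed
      then show "y \<in> {x}" by (simp add: coord_eqI)
    qed
  qed
  then have "x extreme_point_of cube"
    by (metis cface_face_of_cube face_of_singleton)
  moreover have "x \<in> perp u"
    using x(3) \<open>t = c * r\<close> by (simp add: perp_def)
  ultimately show False
    using assms by blast
qed

text \<open>The section has a point whose active labels are exactly those of \<open>S\<close>; it
  lies in \<open>cface T\<close> only if \<open>T\<close> is contained in \<open>S\<close>.\<close>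

lemma cface_perp_subset_iff:
  assumes "S \<in> met u"
  shows "cface S \<inter> perp u \<subseteq> cface T \<inter> perp u \<longleftrightarrow> T \<subseteq> S"
proof
  assume *: "cface S \<inter> perp u \<subseteq> cface T \<inter> perp u"
  obtain x where "x \<in> cube" "x \<in> perp u" "active x = S"
    using exists_active_eq[OF assms] .
  then show "T \<subseteq> S"
    using * by (metis IntD1 IntI mem_cface_iff order_refl subsetD)
next
  assume "T \<subseteq> S"
  then have "cface S \<subseteq> cface T"
    by (auto simp: cface_def)
  then show "cface S \<inter> perp u \<subseteq> cface T \<inter> perp u"
    by blast
qed

lemma bij_betw_met_faces:
  assumes "generic u"
  shows "bij_betw (\<lambda>S. cface S \<inter> perp u) (met u) (faces (cube \<inter> perp u) - {{}})"
  unfolding bij_betw_def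
proof
  show "inj_on (\<lambda>S. cface S \<inter> perp u) (met u)"
    by (rule inj_onI) (metis cface_perp_subset_iff subset_antisym subset_refl)
  have "cface S \<inter> perp u \<noteq> {}" if S: "S \<in> met u" for S
  proof -
    obtain x where "x \<in> cube" "x \<in> perp u" "active x = S"
      using exists_active_eq[OF S] .
    then show ?thesis by (auto simp: mem_cface_iff)
  qed
  moreover have "\<exists>S\<in>met u. F = cface S \<inter> perp u"
    if F: "F face_of (cube \<inter> perp u)" "F \<noteq> {}" for F
  proof -
    obtain x where "x \<in> cube" "x \<in> perp u" "F = cface (active x) \<inter> perp u"
      using face_eq_cface[OF F] .
    then show ?thesis
      using met_if_active[OF assms] by blast
  qed
  ultimately show "(\<lambda>S. cface S \<inter> perp u) ` met u = faces (cube \<inter> perp u) - {{}}"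
    using cface_perp_face_of by (auto simp: faces_def)
qed

text \<open>Both face correspondences reverse inclusion, so their composite with a face isomorphism
  preserves it. The empty face, which corresponds to no met set, is the least face and can be
  removed or put back.\<close>

lemma combinatorially_equivalent_iff_met:
  fixes u :: "real ^ 'm" and v :: "real ^ 'n"
  assumes u: "generic u" and v: "generic v"
  shows "combinatorially_equivalent (cube \<inter> perp u) (cube \<inter> perp v) \<longleftrightarrow>
    (\<exists>g. bij_betw g (met u) (met v) \<and> (\<forall>S\<in>met u. \<forall>T\<in>met u. S \<subseteq> T \<longleftrightarrow> g S \<subseteq> g T))"
    (is "_ \<longleftrightarrow> ?R")
proof -
  define P where "P = cube \<inter> perp u"
  define Q where "Q = cube \<inter> perp v"
  define h where "h = (\<lambda>S. cface S \<inter> perp u)"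
  define k where "k = (\<lambda>S. cface S \<inter> perp v)"
  have h: "bij_betw h (met u) (faces P - {{}})"
    unfolding h_def P_def by (rule bij_betw_met_faces[OF u])
  have k: "bij_betw k (met v) (faces Q - {{}})"
    unfolding k_def Q_def by (rule bij_betw_met_faces[OF v])
  have h_mono: "h S \<subseteq> h T \<longleftrightarrow> T \<subseteq> S" if "S \<in> met u" for S T
    unfolding h_def by (rule cface_perp_subset_iff[OF that])
  have k_mono: "k S \<subseteq> k T \<longleftrightarrow> T \<subseteq> S" if "S \<in> met v" for S T
    unfolding k_def by (rule cface_perp_subset_iff[OF that])
  have empty: "{} \<in> faces P" "{} \<in> faces Q"
    by (simp_all add: faces_def)
  define h' where "h' = inv_into (met u) h"
  define k' where "k' = inv_into (met v) k"
  have h': "bij_betw h' (faces P - {{}}) (met u)"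
    unfolding h'_def by (rule bij_betw_inv_into[OF h])
  have k': "bij_betw k' (faces Q - {{}}) (met v)"
    unfolding k'_def by (rule bij_betw_inv_into[OF k])
  have hh': "h (h' F) = F" if "F \<in> faces P - {{}}" for F
    unfolding h'_def by (rule bij_betw_inv_into_right[OF h that])
  have kk': "k (k' F) = F" if "F \<in> faces Q - {{}}" for F
    unfolding k'_def by (rule bij_betw_inv_into_right[OF k that])
  show ?thesis
    unfolding P_def[symmetric] Q_def[symmetric]
  proof
    assume "combinatorially_equivalent P Q"
    then obtain f where f: "bij_betw f (faces P) (faces Q)"
      and "\<forall>F\<in>faces P. \<forall>G\<in>faces P. F \<subseteq> G \<longleftrightarrow> f F \<subseteq> f G"
      unfolding combinatorially_equivalent_def by (elim exE conjE)
    then have f_mono: "F \<subseteq> G \<longleftrightarrow> f F \<subseteq> f G" if "F \<in> faces P" "G \<in> faces P" for F G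
      using that by simp
    \<comment> \<open>Since \<open>{}\<close> is contained in this \<open>F\<close>, its image is
      contained in \<open>f F\<close>, which is empty.\<close>
    obtain F where "F \<in> faces P" "f F = {}"
      using f empty(2) unfolding bij_betw_def by (metis imageE)
    then have "f {} = {}"
      using f_mono[of "{}" F] empty(1) by auto
    then have f0: "bij_betw f (faces P - {{}}) (faces Q - {{}})"
      using bij_betw_DiffI[OF f, of "{{}}" "{{}}"] empty by (simp add: bij_betw_def)
    define g where "g = k' \<circ> f \<circ> h"
    have "bij_betw g (met u) (met v)"
      unfolding g_def by (rule bij_betw_trans[OF h bij_betw_trans[OF f0 k']])
    moreover have "S \<subseteq> T \<longleftrightarrow> g S \<subseteq> g T" if S: "S \<in> met u" and T: "T \<in> met u" for S T
    proof -
      have hS: "h S \<in> faces P - {{}}" "h T \<in> faces P - {{}}"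
        using h S T bij_betwE by blast+
      then have fh: "f (h S) \<in> faces Q - {{}}" "f (h T) \<in> faces Q - {{}}"
        using f0 bij_betwE by blast+
      then have "k (g S) = f (h S)" "k (g T) = f (h T)"
        by (simp_all add: g_def kk')
      moreover have "g T \<in> met v"
        using \<open>bij_betw g (met u) (met v)\<close> T bij_betwE by blast
      ultimately show ?thesis
        using h_mono[OF T, of S] k_mono[of "g T" "g S"] f_mono[of "h T" "h S"] hS by simp
    qed
    ultimately show ?R by (intro exI[of _ g]) simp
  next
    assume ?R
    then obtain g where g: "bij_betw g (met u) (met v)"
      and "\<forall>S\<in>met u. \<forall>T\<in>met u. S \<subseteq> T \<longleftrightarrow> g S \<subseteq> g T"
      by (elim exE conjE)
    then have g_mono: "S \<subseteq> T \<longleftrightarrow> g S \<subseteq> g T" if "S \<in> met u" "T \<in> met u" for S T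
      using that by simp
    define f where "f F = (if F = {} then {} else k (g (h' F)))" for F
    have "bij_betw (k \<circ> g \<circ> h') (faces P - {{}}) (faces Q - {{}})"
      by (rule bij_betw_trans[OF h' bij_betw_trans[OF g k]])
    then have f0: "bij_betw f (faces P - {{}}) (faces Q - {{}})"
      by (rule bij_betw_cong[THEN iffD1, rotated]) (auto simp: f_def)
    moreover have "bij_betw f {{}} {{}}"
      by (simp add: bij_betw_def f_def)
    ultimately have "bij_betw f ((faces P - {{}}) \<union> {{}}) ((faces Q - {{}}) \<union> {{}})"
      by (rule bij_betw_combine) auto
    then have f: "bij_betw f (faces P) (faces Q)"
      using empty by (simp add: insert_absorb)
    moreover have "F \<subseteq> G \<longleftrightarrow> f F \<subseteq> f G" if F: "F \<in> faces P" and G: "G \<in> faces P" for F G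
    proof (cases "F = {} \<or> G = {}")
      case True
      moreover have "f F = {} \<longleftrightarrow> F = {}"
        using f0 F bij_betwE unfolding f_def by fastforce
      ultimately show ?thesis
        by (auto simp: f_def)
    next
      case False
      then have FG: "F \<in> faces P - {{}}" "G \<in> faces P - {{}}"
        using F G by auto
      then have m: "h' F \<in> met u" "h' G \<in> met u"
        using h' bij_betwE by blast+
      then have "g (h' F) \<in> met v"
        using g bij_betwE by blast
      then have "f F \<subseteq> f G \<longleftrightarrow> g (h' G) \<subseteq> g (h' F)"
        using False k_mono by (simp add: f_def)
      also have "\<dots> \<longleftrightarrow> h (h' F) \<subseteq> h (h' G)"
        using m g_mono h_mono by simp
      finally show ?thesis
        using hh' FG by simp
    qed
    ultimately show "combinatorially_equivalent P Q"
      unfolding combinatorially_equivalent_def by (intro exI[of _ f]) simp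
  qed
qed

section \<open>The simplicial complex of met sets and the edges of the cube\<close>

lemma load_insert:
  "p \<notin> S \<Longrightarrow> load u (insert p S) = \<bar>coord u p + (\<Sum>q\<in>S. coord u q)\<bar> + \<bar>coord u p\<bar> + (\<Sum>q\<in>S. \<bar>coord u q\<bar>)"
  by (simp add: load_def)

text \<open>Loads grow with the set: added labels lower the absolute value of the signed sum by at
  most their total weight, which the other summand gains.\<close>

lemma met_subset:
  assumes "S \<in> met u" "T \<subseteq> S"
  shows "T \<in> met u"
proof -
  have "load u T \<le> load u S"
  proof -
    have "S = T \<union> (S - T)" "T \<inter> (S - T) = {}" using assms(2) by auto
    then have *: "sum f S = sum f T + sum f (S - T)" for f :: "_ \<Rightarrow> real"
      by (metis finite sum.union_disjoint)
    have "\<bar>\<Sum>p\<in>S - T. coord u p\<bar> \<le> (\<Sum>p\<in>S - T. \<bar>coord u p\<bar>)"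
      by (rule sum_abs)
    then show ?thesis
      unfolding load_def *[of "coord u"] *[of "\<lambda>p. \<bar>coord u p\<bar>"] by linarith
  qed
  then show ?thesis
    using assms consistent_subset by (force simp: met_def)
qed

text \<open>This is the central symmetry of the section.\<close>

lemma met_neg_image_iff: "neg ` S \<in> met u \<longleftrightarrow> S \<in> met u"
proof -
  have "load u (neg ` S) = load u S"
    by (simp add: load_def sum.reindex sum_negf)
  moreover have "consistent (neg ` S) \<longleftrightarrow> consistent S"
    by (auto simp: consistent_def in_neg_image_iff)
  ultimately show ?thesis
    by (simp add: met_def)
qed

lemma unsupported_nonempty_if_met:
  assumes "S \<in> met u"
  shows "unsupported S \<noteq> {}"
proof
  assume "unsupported S = {}"
  then have "(\<Sum>p\<in>S. \<bar>coord u p\<bar>) = l1 u"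
    using sum_unsupported[of S u] assms by (simp add: met_def)
  then show False
    using assms by (simp add: met_def load_def)
qed

text \<open>With two free coordinates a further label could be added, so a maximal met set leaves
  only one coordinate free and belongs to an edge of the cube.\<close>

lemma unsupported_if_maximal:
  assumes u: "generic u" and S: "S \<in> met u" and max: "\<And>T. T \<in> met u \<Longrightarrow> S \<subseteq> T \<Longrightarrow> T = S"
    and p: "p \<in> unsupported S" and q: "q \<in> unsupported S"
  shows "q = p \<or> q = neg p"
proof (rule ccontr)
  assume neq: "\<not> ?thesis"
  have cS: "consistent S" and lS: "load u S < l1 u"
    using S by (auto simp: met_def)
  have "q \<in> unsupported (insert p S)"
    using q neq by (auto simp: unsupported_def)
  then have c: "consistent (insert q (insert p S))"
    using cS p by (simp add: consistent_insert)
  have notin: "p \<notin> S" "neg p \<notin> S" "q \<notin> S" "neg q \<notin> S"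
    using p q by (auto simp: unsupported_def)
  have pq: "\<bar>coord u p\<bar> + \<bar>coord u q\<bar> + (\<Sum>p\<in>S. \<bar>coord u p\<bar>) \<le> l1 u"
    using sum_abs_coord_le[OF c, of u] notin neq by simp
  \<comment> \<open>Fix the lighter of the two free coordinates, with the sign opposite to that of the sum over \<open>S\<close>.\<close>
  have "\<exists>r. r \<in> unsupported S \<and> 2 * \<bar>coord u r\<bar> + (\<Sum>p\<in>S. \<bar>coord u p\<bar>) \<le> l1 u
         \<and> \<bar>coord u r + (\<Sum>p\<in>S. coord u p)\<bar> = \<bar>\<bar>coord u r\<bar> - \<bar>\<Sum>p\<in>S. coord u p\<bar>\<bar>"
  proof -
    define r where "r = (if \<bar>coord u p\<bar> \<le> \<bar>coord u q\<bar> then p else q)"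
    define r' where "r' = (if (coord u r > 0) = ((\<Sum>p\<in>S. coord u p) > 0) then neg r else r)"
    have "r \<in> unsupported S" using p q by (simp add: r_def)
    then have "r' \<in> unsupported S"
      by (auto simp: r'_def unsupported_def)
    moreover have "\<bar>coord u r'\<bar> = \<bar>coord u r\<bar>" by (simp add: r'_def)
    moreover have "2 * \<bar>coord u r\<bar> \<le> \<bar>coord u p\<bar> + \<bar>coord u q\<bar>" by (auto simp: r_def)
    moreover have "\<bar>coord u r' + (\<Sum>p\<in>S. coord u p)\<bar> = \<bar>\<bar>coord u r'\<bar> - \<bar>\<Sum>p\<in>S. coord u p\<bar>\<bar>"
      unfolding r'_def by auto
    ultimately show ?thesis using pq by (intro exI[of _ r']) auto
  qed
  then obtain r where r: "r \<in> unsupported S" "2 * \<bar>coord u r\<bar> + (\<Sum>p\<in>S. \<bar>coord u p\<bar>) \<le> l1 u"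
    "\<bar>coord u r + (\<Sum>p\<in>S. coord u p)\<bar> = \<bar>\<bar>coord u r\<bar> - \<bar>\<Sum>p\<in>S. coord u p\<bar>\<bar>"
    by blast
  have rS: "r \<notin> S" using r(1) by (simp add: unsupported_def)
  have cr: "consistent (insert r S)"
    using consistent_insert[OF cS r(1)] .
  \<comment> \<open>If \<open>r\<close> weighs at most the absolute signed sum over
    \<open>S\<close>, the load does not change. Otherwise it is at most twice the weight of
    \<open>r\<close> plus the weight of \<open>S\<close>.\<close>
  have "load u (insert r S) \<le> l1 u"
    unfolding load_insert[OF rS] using r(2,3) lS[unfolded load_def] by linarith
  then have "insert r S \<in> met u"
    using u cr by (force simp: met_def generic_def)
  then show False
    using max[of "insert r S"] rS by auto
qed

lemma cface_edge_of_cube: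
  assumes S: "consistent S" and p: "unsupported S = {p, neg p}"
  shows "cface S edge_of (cube :: (real ^ 'n) set)"
proof -
  have cp: "consistent (insert p S)" "consistent (insert (neg p) S)"
    using p by (auto intro: consistent_insert[OF S])
  \<comment> \<open>Only the prescribed coordinates matter here, so the vector and the free value
    are both taken to be 0.\<close>
  have ex: "\<exists>a :: real ^ 'n. \<forall>q\<in>T. coord a q = 1" if "consistent T" for T
    by (rule exists_balanced_point[OF that, of 0 0]) auto
  obtain a :: "real ^ 'n" where a: "\<And>q. q \<in> insert p S \<Longrightarrow> coord a q = 1"
    using ex[OF cp(1)] by blast
  obtain b :: "real ^ 'n" where b: "\<And>q. q \<in> insert (neg p) S \<Longrightarrow> coord b q = 1"
    using ex[OF cp(2)] by blast
  have bp: "coord b p = - 1" using b[of "neg p"] by simp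
  have cases4: "q \<in> S \<or> neg q \<in> S \<or> q = p \<or> q = neg p" for q
    using p unfolding unsupported_def by blast
  have neg1: "coord x q = - 1" if "coord x (neg q) = 1" for x :: "real ^ 'n" and q
    using that by simp
  have "cface S = closed_segment a b"
  proof
    show "cface S \<subseteq> closed_segment a b"
    proof
      fix x assume x: "x \<in> cface S"
      \<comment> \<open>The position on the segment is read off the free coordinate, which is 1 at
        \<open>a\<close> and -1 at \<open>b\<close>.\<close>
      define s where "s = (1 - coord x p) / 2"
      have "x \<in> cube" using x by (simp add: mem_cface_iff)
      then have s: "0 \<le> s" "s \<le> 1"
        using abs_coord_le_1[of x p] by (auto simp: s_def)
      have "coord x q = coord ((1 - s) *\<^sub>R a + s *\<^sub>R b) q" for q
      proof -
        consider "q \<in> S" | "neg q \<in> S" | "q = p" | "q = neg p" using cases4 by blast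
        then show ?thesis
        proof cases
          case 1
          then show ?thesis using a b x by (simp add: coord_add coord_scaleR cface_def)
        next
          case 2
          then have "coord a q = - 1" "coord b q = - 1" "coord x q = - 1"
            using a b x by (auto intro!: neg1 simp: cface_def)
          then show ?thesis by (simp add: coord_add coord_scaleR)
        next
          case 3
          then show ?thesis using a[of p] bp by (simp add: coord_add coord_scaleR s_def field_simps)
        next
          case 4
          then show ?thesis using a[of p] bp by (simp add: coord_add coord_scaleR s_def field_simps)
        qed
      qed
      then have "x = (1 - s) *\<^sub>R a + s *\<^sub>R b" by (rule coord_eqI)
      then show "x \<in> closed_segment a b"
        using s by (auto simp: in_segment)
    qed
    have "\<bar>coord a q\<bar> = 1 \<and> \<bar>coord b q\<bar> = 1" for q
      using cases4[of q] a[of q] a[of "neg q"] b[of q] b[of "neg q"] a[of p] bp by auto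
    then have "coord a q \<le> 1 \<and> coord b q \<le> 1" for q
      by (metis abs_ge_self)
    then have "a \<in> cface S" "b \<in> cface S"
      using a b by (auto simp: cface_def)
    then show "closed_segment a b \<subseteq> cface S"
      by (rule closed_segment_subset[OF _ _ face_of_imp_convex[OF cface_face_of_cube]])
  qed
  moreover have "a \<noteq> b"
    using a[of p] bp by auto
  then have "aff_dim (closed_segment a b) = 1"
    by (simp add: segment_convex_hull aff_dim_convex_hull aff_dim_2)
  ultimately show ?thesis
    by (simp add: edge_of_def cface_face_of_cube[of S, unfolded \<open>cface S = closed_segment a b\<close>])
qed

text \<open>A met set extends to a maximal one, whose cube face is an edge met by
  \<open>perp u\<close>, hence by \<open>perp v\<close>. All labels of the given set are active at a
  point of that edge on \<open>perp v\<close>.\<close>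

lemma met_subset_if_edges_met:
  fixes u v :: "real ^ 'n"
  assumes u: "generic u" and v: "generic v" and e: "edges_met u \<subseteq> edges_met v"
  shows "met u \<subseteq> met v"
proof
  fix S assume "S \<in> met u"
  then obtain M where M: "M \<in> met u" "S \<subseteq> M" and max: "\<And>T. T \<in> met u \<Longrightarrow> M \<subseteq> T \<Longrightarrow> T = M"
    using finite_has_maximal2[of "met u" S] finite by metis
  obtain p where p: "p \<in> unsupported M"
    using unsupported_nonempty_if_met[OF M(1)] by blast
  have "unsupported M = {p, neg p}"
    using unsupported_if_maximal[OF u M(1) max p] p by (auto simp: unsupported_def)
  then have "cface M edge_of (cube :: (real ^ 'n) set)"
    using M(1) cface_edge_of_cube by (auto simp: met_def)
  moreover obtain x where "x \<in> cube" "x \<in> perp u" "active x = M"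
    using exists_active_eq[OF M(1)] .
  then have "cface M \<inter> perp u \<noteq> {}"
    by (auto simp: mem_cface_iff)
  ultimately have "cface M \<in> edges_met v"
    using e by (auto simp: edges_met_def)
  then obtain y where "y \<in> cface M" "y \<in> perp v"
    by (auto simp: edges_met_def)
  then show "S \<in> met v"
    using met_if_active[OF v, of y S] M(2) by (auto simp: mem_cface_iff)
qed

lemma edges_met_eq:
  fixes u :: "real ^ 'n"
  assumes "generic u"
  shows "edges_met u = {e. e edge_of cube \<and> (\<exists>S\<in>met u. e = cface S)}"
proof -
  have "e \<inter> perp u \<noteq> {} \<longleftrightarrow> (\<exists>S\<in>met u. e = cface S)" if e: "e edge_of cube" for e :: "(real ^ 'n) set"
  proof
    assume "e \<inter> perp u \<noteq> {}"
    then obtain y where y: "y \<in> e" "y \<in> perp u" by blast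
    \<comment> \<open>\<open>perp 0\<close> is the whole space, so the description of the faces of a
      section applies to the cube itself.\<close>
    have "e face_of (cube \<inter> perp 0)" "e \<noteq> {}"
      using e y by (auto simp: edge_of_def perp_def)
    then obtain x where x: "e = cface (active x) \<inter> perp 0"
      using face_eq_cface by metis
    then have "e = cface (active x)" by (simp add: perp_def)
    then show "\<exists>S\<in>met u. e = cface S"
      using y met_if_active[OF assms] by (metis mem_cface_iff)
  next
    assume "\<exists>S\<in>met u. e = cface S"
    then obtain S where S: "S \<in> met u" "e = cface S" by blast
    obtain x where "x \<in> cube" "x \<in> perp u" "active x = S"
      using exists_active_eq[OF S(1)] .
    then show "e \<inter> perp u \<noteq> {}"
      using S by (auto simp: mem_cface_iff)
  qed
  then show ?thesis
    unfolding edges_met_def by blast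
qed

lemma edges_met_eq_iff:
  assumes "generic u" "generic v"
  shows "edges_met u = edges_met v \<longleftrightarrow> met u = met v"
  using assms met_subset_if_edges_met[of u v] met_subset_if_edges_met[of v u]
  by (auto simp: edges_met_eq)

section \<open>The action of signed permutations on loads and met sets\<close>

lemma coord_signed_act:
  assumes "\<pi> \<in> signed_perms"
  shows "coord (signed_act \<pi> u) p = coord u (\<pi> p)"
proof (cases p)
  case (Neg i)
  then have "\<pi> p = neg (\<pi> (Pos i))"
    using assms unfolding signed_perms_def by (metis (mono_tags, lifting) mem_Collect_eq neg.simps(1))
  then show ?thesis
    using Neg by (simp add: signed_act_def)
qed (simp add: signed_act_def)

lemma l1_signed_act:
  assumes "\<pi> \<in> signed_perms"
  shows "l1 (signed_act \<pi> u) = l1 u"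
proof -
  have "bij \<pi>" using assms by (simp add: signed_perms_def)
  then have "(\<Sum>p\<in>UNIV. \<bar>coord u (\<pi> p)\<bar>) = (\<Sum>p\<in>UNIV. \<bar>coord u p\<bar>)"
    by (rule sum.reindex_bij_betw)
  then show ?thesis
    using sum_abs_coord[of "signed_act \<pi> u"] by (simp add: sum_abs_coord coord_signed_act[OF assms])
qed

lemma load_signed_act:
  assumes "\<pi> \<in> signed_perms"
  shows "load (signed_act \<pi> u) S = load u (\<pi> ` S)"
proof -
  have "inj \<pi>"
    using assms by (simp add: signed_perms_def bij_def)
  then have "inj_on \<pi> S"
    by (rule inj_on_subset) simp
  then show ?thesis
    by (simp add: load_def sum.reindex coord_signed_act[OF assms])
qed

lemma consistent_image_iff:
  assumes "\<pi> \<in> signed_perms"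
  shows "consistent (\<pi> ` S) \<longleftrightarrow> consistent S"
proof -
  have "inj \<pi>" and neg: "\<And>p. neg (\<pi> p) = \<pi> (neg p)"
    using assms by (auto simp: signed_perms_def bij_def)
  then show ?thesis
    by (simp add: consistent_def inj_image_mem_iff)
qed

lemma met_signed_act:
  assumes "\<pi> \<in> signed_perms"
  shows "S \<in> met (signed_act \<pi> u) \<longleftrightarrow> \<pi> ` S \<in> met u"
  by (simp add: met_def load_signed_act[OF assms] l1_signed_act[OF assms] consistent_image_iff[OF assms])

lemma generic_signed_act:
  assumes "\<pi> \<in> signed_perms" "generic u"
  shows "generic (signed_act \<pi> u)"
  using assms(2) consistent_image_iff[OF assms(1)]
  by (simp add: generic_def load_signed_act[OF assms(1)] l1_signed_act[OF assms(1)])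

section \<open>Isomorphisms of simplicial complexes\<close>

text \<open>The inclusion order singles out the empty simplex as least element and the vertices as
  the minimal nonempty simplices, and a simplex is determined by the vertices below it.\<close>

lemma simplicial_isomorphism_induced_by_vertices:
  assumes D: "\<And>S T. S \<in> D \<Longrightarrow> T \<subseteq> S \<Longrightarrow> T \<in> D"
    and E: "\<And>S T. S \<in> E \<Longrightarrow> T \<subseteq> S \<Longrightarrow> T \<in> E"
    and ne: "{} \<in> D" "{} \<in> E"
    and g: "bij_betw g D E"
    and mono: "\<And>S T. S \<in> D \<Longrightarrow> T \<in> D \<Longrightarrow> S \<subseteq> T \<longleftrightarrow> g S \<subseteq> g T"
  shows "\<exists>\<phi>. bij_betw \<phi> (\<Union>D) (\<Union>E) \<and> (\<forall>S \<subseteq> \<Union>D. S \<in> D \<longleftrightarrow> \<phi> ` S \<in> E)"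
proof -
  have gE: "g S \<in> E" if "S \<in> D" for S
    using g that bij_betwE by blast
  have inj: "S = T" if "S \<in> D" "T \<in> D" "g S = g T" for S T
    using mono that by (metis subset_antisym subset_refl)
  have surj: "\<exists>S\<in>D. g S = R" if "R \<in> E" for R
    using g that unfolding bij_betw_def by (metis imageE)
  have sD: "{p} \<in> D \<longleftrightarrow> p \<in> \<Union>D" for p
    using D by blast
  have sE: "{q} \<in> E \<longleftrightarrow> q \<in> \<Union>E" for q
    using E by blast
  have g0: "g {} = {}"
  proof -
    obtain S where S: "S \<in> D" "g S = {}" using surj ne(2) by blast
    then show ?thesis using mono[of "{}" S] ne(1) by simp
  qed
  have single: "\<exists>q. g {p} = {q}" if p: "p \<in> \<Union>D" for p
  proof -
    have pD: "{p} \<in> D" using p sD by simp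
    have "g {p} \<noteq> {}" using inj[of "{p}" "{}"] pD ne(1) g0 by auto
    then obtain q where q: "q \<in> g {p}" by blast
    then have "{q} \<in> E" using E[OF gE[OF pD], of "{q}"] by simp
    then obtain S where S: "S \<in> D" "g S = {q}" using surj by blast
    then have "S \<subseteq> {p}" using mono[of S "{p}"] pD q by simp
    moreover have "S \<noteq> {}" using S g0 by auto
    ultimately show ?thesis using S(2) by (metis subset_singletonD)
  qed
  define \<phi> where "\<phi> p = the_elem (g {p})" for p
  have \<phi>: "g {p} = {\<phi> p}" if "p \<in> \<Union>D" for p
    using single[OF that] unfolding \<phi>_def by (elim exE) simp
  have \<phi>_inj: "inj_on \<phi> (\<Union>D)"
  proof (rule inj_onI)
    fix p q assume pq: "p \<in> \<Union>D" "q \<in> \<Union>D" "\<phi> p = \<phi> q"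
    then have "g {p} = g {q}" by (simp only: \<phi>)
    then have "{p} = {q}" using inj[of "{p}" "{q}"] pq(1,2)[folded sD] by simp
    then show "p = q" by simp
  qed
  \<comment> \<open>The simplex mapped to \<open>{q}\<close> is nonempty, and any vertex of it is
    mapped into \<open>{q}\<close>.\<close>
  have pre: "\<exists>p\<in>\<Union>D. g {p} = {q} \<and> q = \<phi> p" if q: "q \<in> \<Union>E" for q
  proof -
    obtain R where R: "R \<in> D" "g R = {q}" using surj q sE by blast
    then have "R \<noteq> {}" using g0 by auto
    then obtain p where p: "p \<in> R" by blast
    then have pD: "p \<in> \<Union>D" using R by blast
    then have "{\<phi> p} \<subseteq> {q}" using mono[of "{p}" R] p R \<phi> sD by simp
    then show ?thesis using pD \<phi>[OF pD] by auto
  qed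
  have img: "g S = \<phi> ` S" if S: "S \<in> D" for S
  proof
    show "g S \<subseteq> \<phi> ` S"
    proof
      fix q assume q: "q \<in> g S"
      then have "q \<in> \<Union>E" using gE[OF S] by blast
      from pre[OF this] obtain p where p: "p \<in> \<Union>D" "g {p} = {q}" "q = \<phi> p"
        by (elim bexE conjE)
      then have "{p} \<subseteq> S" using mono[of "{p}" S] S sD q by simp
      then show "q \<in> \<phi> ` S" using p(3) by simp
    qed
    show "\<phi> ` S \<subseteq> g S"
    proof
      fix q assume "q \<in> \<phi> ` S"
      then obtain p where p: "p \<in> S" "q = \<phi> p" by blast
      then have pD: "p \<in> \<Union>D" using S by blast
      then show "q \<in> g S" using mono[of "{p}" S] S sD p \<phi>[OF pD] by simp
    qed
  qed
  show ?thesis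
  proof (intro exI conjI allI impI)
    have "\<phi> ` \<Union>D = \<Union>E"
    proof
      show "\<phi> ` \<Union>D \<subseteq> \<Union>E"
      proof (rule image_subsetI)
        fix p assume p: "p \<in> \<Union>D"
        then show "\<phi> p \<in> \<Union>E"
          using gE[of "{p}"] unfolding sD[symmetric] \<phi>[OF p] by blast
      qed
      show "\<Union>E \<subseteq> \<phi> ` \<Union>D"
      proof
        fix q assume "q \<in> \<Union>E"
        from pre[OF this] show "q \<in> \<phi> ` \<Union>D"
          by (elim bexE conjE) (simp only: imageI)
      qed
    qed
    then show "bij_betw \<phi> (\<Union>D) (\<Union>E)"
      using \<phi>_inj by (simp add: bij_betw_def)
    fix S assume S: "S \<subseteq> \<Union>D"
    show "S \<in> D \<longleftrightarrow> \<phi> ` S \<in> E"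
    proof
      assume "S \<in> D" then show "\<phi> ` S \<in> E" using gE[of S] img by simp
    next
      assume "\<phi> ` S \<in> E"
      \<comment> \<open>\<open>g\<close> can be applied only to members of \<open>D\<close>, so
        \<open>S\<close> is recovered from a preimage \<open>R\<close> by injectivity of
        \<open>\<phi>\<close>.\<close>
      from surj[OF this] obtain R where R: "R \<in> D" "g R = \<phi> ` S" by (elim bexE)
      then have "\<phi> ` R = \<phi> ` S" "R \<subseteq> \<Union>D" using img by auto
      then have "R = S" using inj_on_image_eq_iff[OF \<phi>_inj _ S] by simp
      then show "S \<in> D" using R by simp
    qed
  qed
qed

section \<open>Long pairs and oddness of the bijection of labels\<close>

text \<open>For distinct adjacent facets: their common face in the cube is missed by
  \<open>perp u\<close>, so their sections are disjoint although the facets are not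
  opposite.\<close>

definition long_pair :: "real ^ 'n \<Rightarrow> 'n signed \<Rightarrow> 'n signed \<Rightarrow> bool" where
  "long_pair u p q \<longleftrightarrow> q \<noteq> p \<and> q \<noteq> neg p \<and> {p, q} \<notin> met u"

lemma consistent_pair: "q \<noteq> neg p \<Longrightarrow> consistent {p, q}"
  by (auto simp: consistent_def)

lemma antipodal_not_met: "{p, neg p} \<notin> met u"
  by (auto simp: met_def consistent_def)

lemma long_pair_neg: "long_pair u p q \<Longrightarrow> long_pair u (neg p) (neg q)"
  using met_neg_image_iff[of "{p, q}" u] by (simp add: long_pair_def neg_eq_swap)

text \<open>With opposite signs or a zero coordinate, the load of the pair would be twice the larger
  of the two weights, which is below \<open>l1 u\<close> because singletons are met.\<close>

lemma long_pair_coord: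
  assumes u: "generic u" and s: "\<And>p. {p} \<in> met u" and l: "long_pair u p q"
  shows "l1 u < 2 * (\<bar>coord u p\<bar> + \<bar>coord u q\<bar>)"
    and "0 < coord u p \<and> 0 < coord u q \<or> coord u p < 0 \<and> coord u q < 0"
proof -
  have c: "consistent {p, q}" and neq: "p \<noteq> q"
    using l by (auto simp: long_pair_def intro: consistent_pair)
  have "load u {p, q} \<noteq> l1 u" "\<not> load u {p, q} < l1 u"
    using u c l by (auto simp: generic_def met_def long_pair_def)
  then have lo: "l1 u < \<bar>coord u p + coord u q\<bar> + (\<bar>coord u p\<bar> + \<bar>coord u q\<bar>)"
    using neq by (simp add: load_def)
  have "2 * \<bar>coord u r\<bar> < l1 u" for r
    using s[of r] by (simp add: met_def load_def)
  note this[of p] this[of q]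
  then show "0 < coord u p \<and> 0 < coord u q \<or> coord u p < 0 \<and> coord u q < 0"
    using lo by argo
  show "l1 u < 2 * (\<bar>coord u p\<bar> + \<bar>coord u q\<bar>)"
    using lo by argo
qed

text \<open>The case in which every facet is met on both sides, so that the induced bijection is
  defined on all labels.\<close>

locale met_isomorphism =
  fixes u v :: "real ^ 'n" and \<phi> :: "'n signed \<Rightarrow> 'n signed"
  assumes generic_u: "generic u" and generic_v: "generic v"
    and bij_\<phi>: "bij \<phi>"
    and met_iff: "\<And>S. S \<in> met u \<longleftrightarrow> \<phi> ` S \<in> met v"
    and singleton_u: "\<And>p. {p} \<in> met u" and singleton_v: "\<And>p. {p} \<in> met v"
begin

lemma phi_eq_iff [simp]: "\<phi> p = \<phi> q \<longleftrightarrow> p = q"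
  using bij_\<phi> by (simp add: bij_def inj_eq)

lemma pair_met_iff: "{p, q} \<in> met u \<longleftrightarrow> {\<phi> p, \<phi> q} \<in> met v"
  using met_iff[of "{p, q}"] by simp

text \<open>The preimages of the opposites of \<open>\<phi> i\<close> and
  \<open>\<phi> (neg i)\<close> form long pairs with \<open>i\<close> and \<open>neg i\<close>,
  because an antipodal pair is never met. The point is that these preimages are opposite to each
  other.\<close>

lemma four_cycle_if_not_odd:
  assumes i: "\<phi> (neg i) \<noteq> neg (\<phi> i)"
  obtains j where "long_pair u i j" "\<phi> j = neg (\<phi> i)" "\<phi> (neg j) = neg (\<phi> (neg i))"
    and "long_pair v (\<phi> i) (\<phi> (neg i))"
proof -
  obtain j where j: "\<phi> j = neg (\<phi> i)"
    using bij_\<phi> by (metis bij_pointE)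
  obtain k where k: "\<phi> k = neg (\<phi> (neg i))"
    using bij_\<phi> by (metis bij_pointE)
  have v: "long_pair v (\<phi> i) (\<phi> (neg i))"
    using i pair_met_iff[of i "neg i"] antipodal_not_met[of i u] by (simp add: long_pair_def)
  have "j \<noteq> i" "j \<noteq> neg i" "k \<noteq> i" "k \<noteq> neg i"
    using i j k by (metis neg_neg neg_neq(1))+
  then have ij: "long_pair u i j" and ik: "long_pair u (neg i) k"
    using pair_met_iff[of i j] pair_met_iff[of "neg i" k] j k antipodal_not_met
    by (simp_all add: long_pair_def)
  \<comment> \<open>Otherwise \<open>j\<close> and \<open>k\<close> form a long pair too. As
    coordinates in a long pair have the same strict sign, the chain \<open>i\<close>,
    \<open>j\<close>, \<open>k\<close>, \<open>neg i\<close> would give \<open>i\<close> and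
    \<open>neg i\<close> the same sign.\<close>
  have "k = neg j"
  proof (rule ccontr)
    assume "k \<noteq> neg j"
    moreover have "k \<noteq> j" using j k by (metis neg_eq_iff neg_neq(1) phi_eq_iff)
    moreover have "{j, k} \<notin> met u"
      using pair_met_iff[of j k] j k long_pair_neg[OF v] by (simp add: long_pair_def)
    ultimately have "long_pair u j k"
      by (simp add: long_pair_def)
    then show False
      using ij ik long_pair_coord(2)[OF generic_u singleton_u] by (smt (verit) coord_neg)
  qed
  then show thesis
    using that[of j] ij j k v by simp
qed

text \<open>Each long pair carries more than half of the total weight \<open>l1 u\<close>, so two of
  them cannot use four different coordinates.\<close>

lemma long_pairs_intersect:
  assumes "long_pair u i j" "long_pair u m n" "m \<noteq> i" "m \<noteq> neg i" "m \<noteq> j" "m \<noteq> neg j"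
  shows "n = i \<or> n = neg i \<or> n = j \<or> n = neg j"
proof (rule ccontr)
  assume n: "\<not> ?thesis"
  have ij: "j \<noteq> i" "j \<noteq> neg i" and mn: "n \<noteq> m" "n \<noteq> neg m"
    using assms by (auto simp: long_pair_def)
  have "m \<in> unsupported {i, j}" "n \<in> unsupported {m, i, j}"
    using assms(3-6) n ij mn unfolding unsupported_def
    by (auto dest: arg_cong[of _ _ neg])
  then have "consistent {n, m, i, j}"
    using ij by (simp add: consistent_insert consistent_pair)
  from sum_abs_coord_le[OF this, of u]
  have "\<bar>coord u n\<bar> + (\<bar>coord u m\<bar> + (\<bar>coord u i\<bar> + \<bar>coord u j\<bar>)) \<le> l1 u"
    using n ij mn assms(3-6) by simp
  then show False
    using long_pair_coord(1)[OF generic_u singleton_u] assms(1,2) by (smt (verit))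
qed

lemma phi_odd: "\<phi> (neg p) = neg (\<phi> p)"
proof (rule ccontr)
  assume "\<phi> (neg p) \<noteq> neg (\<phi> p)"
  then obtain q where pq: "long_pair u p q" and q: "\<phi> q = neg (\<phi> p)" "\<phi> (neg q) = neg (\<phi> (neg p))"
    and v: "long_pair v (\<phi> p) (\<phi> (neg p))"
    by (rule four_cycle_if_not_odd)
  \<comment> \<open>A second failure at \<open>m\<close> would give a long pair \<open>m\<close>,
    \<open>n\<close> with \<open>n\<close> among the labels of \<open>p\<close> and
    \<open>q\<close>. The images of these four labels are closed under \<open>neg\<close>, so
    \<open>\<phi> m\<close>, the opposite of \<open>\<phi> n\<close>, would be one of them, contrary
    to injectivity.\<close>
  have odd: "\<phi> (neg m) = neg (\<phi> m)" if m: "m \<in> unsupported {p, q}" for m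
  proof (rule ccontr)
    assume "\<phi> (neg m) \<noteq> neg (\<phi> m)"
    then obtain n where mn: "long_pair u m n" "\<phi> n = neg (\<phi> m)" "\<phi> (neg n) = neg (\<phi> (neg m))"
      by (rule four_cycle_if_not_odd)
    have m': "m \<noteq> p" "m \<noteq> neg p" "m \<noteq> q" "m \<noteq> neg q"
      using m by (auto simp: unsupported_def)
    from long_pairs_intersect[OF pq mn(1) m']
    consider "n = p" | "n = neg p" | "n = q" | "n = neg q" by blast
    then show False
    proof cases
      case 1
      then have "\<phi> m = \<phi> q" using mn(2) q(1) by simp
      then show False using m' by simp
    next
      case 2
      then have "\<phi> m = \<phi> (neg q)" using mn(2) q(2) by simp
      then show False using m' by (metis phi_eq_iff)
    next
      case 3
      then have "\<phi> m = \<phi> p" using mn(2) q(1) by simp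
      then show False using m' by simp
    next
      case 4
      then have "\<phi> m = \<phi> (neg p)" using mn(2) q(2) by simp
      then show False using m' by (metis phi_eq_iff)
    qed
  qed
  \<comment> \<open>\<open>T\<close> fixes all other coordinates. The sections are centrally symmetric, so \<open>insert L W\<close> and
    \<open>insert K (neg ` W)\<close> are both met or both not met. As \<open>K\<close>, \<open>L\<close> is a long pair, this says that
    \<open>B < \<bar>coord v K\<bar> - \<bar>coord v L\<bar>\<close> if and only if \<open>B > \<bar>coord v K\<bar> - \<bar>coord v L\<bar>\<close>, up to a common sign.\<close>
  define T where "T = range Pos \<inter> unsupported {p, q}"
  define W where "W = \<phi> ` T"
  define K where "K = \<phi> p"
  define L where "L = \<phi> (neg p)"
  have KL: "L \<noteq> K" "L \<noteq> neg K"
    using v by (auto simp: long_pair_def K_def L_def)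
  have T: "consistent T"
    by (auto simp: T_def consistent_def)
  have T_cover: "r \<in> T \<or> neg r \<in> T" if "r \<in> unsupported {p, q}" for r
    using that by (cases r) (auto simp: T_def unsupported_def)
  have oddT: "\<phi> (neg m) = neg (\<phi> m)" if "m \<in> T" for m
    using that odd by (simp add: T_def)
  have negW: "neg ` W = \<phi> ` neg ` T"
    unfolding W_def image_image using oddT by (simp cong: image_cong)
  have W: "consistent W"
    unfolding consistent_def W_def
  proof
    fix r assume "r \<in> \<phi> ` T"
    then obtain m where m: "m \<in> T" "r = \<phi> m" by blast
    then have "neg r = \<phi> (neg m)" using oddT by simp
    moreover have "neg m \<notin> T" using T m by (simp add: consistent_def)
    ultimately show "neg r \<notin> \<phi> ` T" by auto
  qed
  have sub: "r \<in> unsupported {K, L}" if r: "r \<in> W" for r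
  proof -
    obtain m where m: "m \<in> T" "r = \<phi> m" using r by (auto simp: W_def)
    then have "m \<notin> {p, neg p, q, neg q}" by (auto simp: T_def unsupported_def)
    then have "\<phi> m \<notin> \<phi> ` {p, neg p, q, neg q}" by auto
    then have "r \<notin> {K, L, neg K, neg L}" using m(2) q by (simp add: K_def L_def)
    then show ?thesis by (auto simp: unsupported_def)
  qed
  have L_un: "L \<in> unsupported W" and K_un: "K \<in> unsupported (insert L W)"
    and K_un': "K \<in> unsupported (neg ` W)"
    using sub KL by (fastforce simp: unsupported_def in_neg_image_iff)+
  have KLW: "consistent (insert K (insert L W))" and LW: "consistent (insert L W)"
    using W L_un K_un by (simp_all add: consistent_insert)
  have "consistent (neg ` W)"
    using W by (auto simp: consistent_def in_neg_image_iff)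
  then have KnW: "consistent (insert K (neg ` W))"
    using K_un' consistent_insert by blast
  \<comment> \<open>\<open>\<phi>\<close> is onto and odd off the four-cycle, so \<open>K\<close>,
    \<open>L\<close> and \<open>W\<close> fix every coordinate; hence their weights add up to
    \<open>l1 v\<close>.\<close>
  have "unsupported (insert K (insert L W)) = {}"
  proof (rule ccontr)
    assume "unsupported (insert K (insert L W)) \<noteq> {}"
    then obtain r where r: "r \<in> unsupported (insert K (insert L W))" by blast
    obtain m where m: "\<phi> m = r" using bij_\<phi> by (metis bij_pointE)
    have "r \<notin> {K, L, neg K, neg L}" "r \<notin> W" "neg r \<notin> W"
      using r by (auto simp: unsupported_def)
    then have "m \<noteq> p" "m \<noteq> neg p" "m \<noteq> q" "m \<noteq> neg q"
      using m q by (auto simp: K_def L_def)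
    then have un: "m \<in> unsupported {p, q}" by (auto simp: unsupported_def)
    from T_cover[OF this] show False
    proof
      assume "m \<in> T"
      then show False using \<open>r \<notin> W\<close> m by (auto simp: W_def)
    next
      assume "neg m \<in> T"
      moreover have "neg r = \<phi> (neg m)" using odd[OF un] m by simp
      ultimately show False using \<open>neg r \<notin> W\<close> by (simp add: W_def)
    qed
  qed
  then have "(\<Sum>r\<in>insert K (insert L W). \<bar>coord v r\<bar>) = l1 v"
    using sum_unsupported[OF KLW, of v] by simp
  then have l1: "\<bar>coord v K\<bar> + \<bar>coord v L\<bar> + (\<Sum>r\<in>W. \<bar>coord v r\<bar>) = l1 v"
    using L_un K_un by (simp add: unsupported_def)
  define B where "B = (\<Sum>r\<in>W. coord v r)"
  have B: "\<bar>B\<bar> \<le> (\<Sum>r\<in>W. \<bar>coord v r\<bar>)"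
    unfolding B_def by (rule sum_abs)
  have "load v (insert L W) = \<bar>coord v L + B\<bar> + \<bar>coord v L\<bar> + (\<Sum>r\<in>W. \<bar>coord v r\<bar>)"
    using L_un by (simp add: load_insert unsupported_def B_def)
  then have LW_met: "insert L W \<in> met v \<longleftrightarrow> \<bar>coord v L + B\<bar> < \<bar>coord v K\<bar>"
    using LW l1 by (auto simp: met_def)
  have load_K: "load v (insert K (neg ` W)) = \<bar>coord v K - B\<bar> + \<bar>coord v K\<bar> + (\<Sum>r\<in>W. \<bar>coord v r\<bar>)"
    using K_un' by (simp add: load_insert unsupported_def B_def sum.reindex sum_negf)
  then have KnW_met: "insert K (neg ` W) \<in> met v \<longleftrightarrow> \<bar>coord v K - B\<bar> < \<bar>coord v L\<bar>"
    using KnW l1 by (auto simp: met_def)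
  have neq: "\<bar>coord v K - B\<bar> \<noteq> \<bar>coord v L\<bar>"
    using generic_v KnW load_K l1 by (auto simp: generic_def)
  have "insert L W = \<phi> ` insert (neg p) T"
    by (simp add: L_def W_def)
  moreover have "insert K (neg ` W) = \<phi> ` neg ` insert (neg p) T"
    by (simp add: K_def negW)
  ultimately have "insert L W \<in> met v \<longleftrightarrow> insert K (neg ` W) \<in> met v"
    by (simp only: met_iff[symmetric] met_neg_image_iff)
  then have "\<bar>coord v L + B\<bar> < \<bar>coord v K\<bar> \<longleftrightarrow> \<bar>coord v K - B\<bar> < \<bar>coord v L\<bar>"
    by (simp only: LW_met KnW_met)
  \<comment> \<open>\<open>K\<close> and \<open>L\<close> have coordinates of the same sign and
    weigh more than \<open>W\<close>, so \<open>\<bar>B\<bar> < \<bar>coord v K\<bar> + \<bar>coord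
    v L\<bar>\<close>. Thus each side of the equivalence has only one effective bound, at the same
    threshold for \<open>B\<close> but in opposite directions; \<open>neq\<close> excludes the
    threshold itself.\<close>
  then show False
    using neq B l1 long_pair_coord[OF generic_v singleton_v v, folded K_def L_def]
    by argo
qed

end

section \<open>Sections that miss a facet\<close>

text \<open>The coordinate of \<open>p\<close> weighs more than half of \<open>l1 u\<close>. A set
  leaving it free therefore weighs less than half, and its load is at most twice its weight.\<close>

lemma met_eq_if_singleton_not_met:
  assumes u: "generic u" and p: "{p} \<notin> met u"
  shows "met u = {S. consistent S \<and> p \<in> unsupported S}"
proof -
  have "consistent {p}" by (simp add: consistent_def)
  then have "load u {p} \<noteq> l1 u" "\<not> load u {p} < l1 u"
    using u p by (auto simp: generic_def met_def)
  then have big: "l1 u < 2 * \<bar>coord u p\<bar>" by (simp add: load_def)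
  have np: "{neg p} \<notin> met u"
    using p met_neg_image_iff[of "{p}" u] by simp
  have "S \<in> met u \<longleftrightarrow> consistent S \<and> p \<in> unsupported S" for S
  proof
    assume S: "S \<in> met u"
    then have "p \<notin> S" "neg p \<notin> S"
      using met_subset[OF S, of "{p}"] met_subset[OF S, of "{neg p}"] p np by auto
    then show "consistent S \<and> p \<in> unsupported S"
      using S by (simp add: unsupported_def met_def)
  next
    assume S: "consistent S \<and> p \<in> unsupported S"
    then have "p \<notin> S" by (simp add: unsupported_def)
    then have "\<bar>coord u p\<bar> + (\<Sum>q\<in>S. \<bar>coord u q\<bar>) \<le> l1 u"
      using sum_abs_coord_le[of "insert p S" u] S by (simp add: consistent_insert)
    moreover have "load u S \<le> 2 * (\<Sum>q\<in>S. \<bar>coord u q\<bar>)"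
      using sum_abs[of "coord u" S] by (simp add: load_def)
    ultimately show "S \<in> met u"
      using big S by (simp add: met_def)
  qed
  then show ?thesis by blast
qed

lemma map_signed_neg: "map_signed f (neg p) = neg (map_signed f p)"
  by (cases p) auto

text \<open>The met sets depend only on which coordinate is dominant, so exchanging the two dominant
  coordinates suffices. By central symmetry the missed facets may be taken with positive
  labels.\<close>

lemma exists_signed_perm_met_eq:
  fixes u v :: "real ^ 'n"
  assumes u: "generic u" and v: "generic v" and p: "{p} \<notin> met u" and q: "{q} \<notin> met v"
  shows "\<exists>\<pi>\<in>signed_perms. met u = met (signed_act \<pi> v)"
proof -
  have Pos: "\<exists>i. {Pos i} \<notin> met w" if "{r} \<notin> met w" for r and w :: "real ^ 'n"
    using that met_neg_image_iff[of "{r}" w] by (cases r) auto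
  obtain i where i: "{Pos i} \<notin> met u" using Pos[OF p] by blast
  obtain j where j: "{Pos j} \<notin> met v" using Pos[OF q] by blast
  define \<pi> where "\<pi> = map_signed (Transposition.transpose i j)"
  have inv: "\<pi> (\<pi> r) = r" for r
    by (cases r) (simp_all add: \<pi>_def)
  then have "bij \<pi>"
    by (rule involuntory_imp_bij)
  then have \<pi>: "\<pi> \<in> signed_perms"
    by (simp add: signed_perms_def \<pi>_def map_signed_neg)
  have ij: "Pos j = \<pi> (Pos i)" "neg (\<pi> (Pos i)) = \<pi> (Neg i)"
    by (simp_all add: \<pi>_def)
  have "inj \<pi>" using \<open>bij \<pi>\<close> by (simp add: bij_def)
  have "S \<in> met u \<longleftrightarrow> S \<in> met (signed_act \<pi> v)" for S
    unfolding met_signed_act[OF \<pi>] met_eq_if_singleton_not_met[OF u i] met_eq_if_singleton_not_met[OF v j]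
    by (simp add: unsupported_def consistent_image_iff[OF \<pi>] ij inj_image_mem_iff[OF \<open>inj \<pi>\<close>])
  then show ?thesis using \<pi> by blast
qed

section \<open>From isomorphic complexes to signed permutations\<close>

lemma empty_in_met: "u \<noteq> 0 \<Longrightarrow> {} \<in> met u"
  by (auto simp: met_def consistent_def load_def l1_def vec_eq_iff
      intro!: sum_pos2)

lemma exists_signed_perm_if_met_isomorphic:
  fixes u v :: "real ^ 'n"
  assumes u: "generic u" "u \<noteq> 0" and v: "generic v" "v \<noteq> 0"
    and g: "bij_betw g (met u) (met v)"
    and mono: "\<And>S T. S \<in> met u \<Longrightarrow> T \<in> met u \<Longrightarrow> S \<subseteq> T \<longleftrightarrow> g S \<subseteq> g T"
  shows "\<exists>\<pi>\<in>signed_perms. met u = met (signed_act \<pi> v)"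
proof -
  have "\<exists>\<phi>. bij_betw \<phi> (\<Union>(met u)) (\<Union>(met v)) \<and>
      (\<forall>S \<subseteq> \<Union>(met u). S \<in> met u \<longleftrightarrow> \<phi> ` S \<in> met v)"
    by (rule simplicial_isomorphism_induced_by_vertices
        [OF met_subset met_subset empty_in_met[OF u(2)] empty_in_met[OF v(2)] g mono])
  then obtain \<phi> where \<phi>: "bij_betw \<phi> (\<Union>(met u)) (\<Union>(met v))"
    and iff: "\<forall>S \<subseteq> \<Union>(met u). S \<in> met u \<longleftrightarrow> \<phi> ` S \<in> met v"
    by (elim exE conjE)
  have single: "{p} \<in> met w" if "\<Union>(met w) = UNIV" for w :: "real ^ 'n" and p
  proof -
    have "p \<in> \<Union>(met w)" using that by simp
    then show ?thesis using met_subset[of _ w "{p}"] by auto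
  qed
  \<comment> \<open>Equally many facets are met on both sides, so either both sections meet all
    facets or both miss one.\<close>
  have card: "card (\<Union>(met u)) = card (\<Union>(met v))"
    using \<phi> by (rule bij_betw_same_card)
  show ?thesis
  proof (cases "\<Union>(met u) = UNIV")
    case True
    then have V: "\<Union>(met v) = UNIV"
      using card by (metis card_subset_eq finite subset_UNIV)
    interpret met_isomorphism u v \<phi>
      by unfold_locales (use u v \<phi> iff True V single in auto)
    have \<pi>: "\<phi> \<in> signed_perms"
      using bij_\<phi> phi_odd by (simp add: signed_perms_def)
    then have "met u = met (signed_act \<phi> v)"
      using met_iff met_signed_act by blast
    then show ?thesis using \<pi> by blast
  next
    case False
    then have "\<Union>(met v) \<noteq> UNIV"
      using card by (metis card_subset_eq finite subset_UNIV)
    then obtain p q where "p \<notin> \<Union>(met u)" "q \<notin> \<Union>(met v)"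
      using False by blast
    then have "{p} \<notin> met u" "{q} \<notin> met v" by auto
    then show ?thesis
      using exists_signed_perm_met_eq u v by blast
  qed
qed

theorem theorem2p2:
  fixes u\<^sub>1 u\<^sub>2 :: "real ^ 'n"
  assumes "u\<^sub>1 \<noteq> 0" and "u\<^sub>2 \<noteq> 0"
    and "\<And>v. v extreme_point_of (cube :: (real ^ 'n) set) \<Longrightarrow> v \<notin> perp u\<^sub>1"
    and "\<And>v. v extreme_point_of (cube :: (real ^ 'n) set) \<Longrightarrow> v \<notin> perp u\<^sub>2"
  shows "combinatorially_equivalent (cube \<inter> perp u\<^sub>1) (cube \<inter> perp u\<^sub>2) \<longleftrightarrow>
         (\<exists>\<pi>\<in>signed_perms. edges_met u\<^sub>1 = edges_met (signed_act \<pi> u\<^sub>2))"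
proof -
  have gen: "generic u\<^sub>1" "generic u\<^sub>2"
    using assms(3,4) by (auto intro: genericI)
  have edges: "edges_met u\<^sub>1 = edges_met (signed_act \<pi> u\<^sub>2) \<longleftrightarrow> met u\<^sub>1 = met (signed_act \<pi> u\<^sub>2)"
    if "\<pi> \<in> signed_perms" for \<pi>
    using edges_met_eq_iff gen generic_signed_act that by blast
  show ?thesis
    unfolding combinatorially_equivalent_iff_met[OF gen]
  proof
    assume "\<exists>g. bij_betw g (met u\<^sub>1) (met u\<^sub>2) \<and>
        (\<forall>S\<in>met u\<^sub>1. \<forall>T\<in>met u\<^sub>1. S \<subseteq> T \<longleftrightarrow> g S \<subseteq> g T)"
    then obtain g where "bij_betw g (met u\<^sub>1) (met u\<^sub>2)"
      and "\<forall>S\<in>met u\<^sub>1. \<forall>T\<in>met u\<^sub>1. S \<subseteq> T \<longleftrightarrow> g S \<subseteq> g T"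
      by (elim exE conjE)
    then have "\<exists>\<pi>\<in>signed_perms. met u\<^sub>1 = met (signed_act \<pi> u\<^sub>2)"
      by (intro exists_signed_perm_if_met_isomorphic[of _ _ g] gen assms(1,2)) simp_all
    then show "\<exists>\<pi>\<in>signed_perms. edges_met u\<^sub>1 = edges_met (signed_act \<pi> u\<^sub>2)"
      using edges by (metis (no_types))
  next
    assume "\<exists>\<pi>\<in>signed_perms. edges_met u\<^sub>1 = edges_met (signed_act \<pi> u\<^sub>2)"
    then obtain \<pi> where \<pi>: "\<pi> \<in> signed_perms" and "met u\<^sub>1 = met (signed_act \<pi> u\<^sub>2)"
      using edges by (metis (no_types))
    then have iff: "S \<in> met u\<^sub>1 \<longleftrightarrow> \<pi> ` S \<in> met u\<^sub>2" for S
      using met_signed_act[OF \<pi>] by simp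
    have "bij \<pi>" using \<pi> by (simp add: signed_perms_def)
    \<comment> \<open>A signed permutation acts on sets of labels by taking images, and this action
      is itself the isomorphism of complexes sought.\<close>
    have "bij_betw ((`) \<pi>) (met u\<^sub>1) (met u\<^sub>2)"
      unfolding bij_betw_def
    proof
      show "inj_on ((`) \<pi>) (met u\<^sub>1)"
        using \<open>bij \<pi>\<close> by (simp add: inj_on_def bij_def inj_image_eq_iff)
      have "T \<in> (`) \<pi> ` met u\<^sub>1" if "T \<in> met u\<^sub>2" for T
      proof -
        have "T = \<pi> ` (\<pi> -` T)" using \<open>bij \<pi>\<close> by (simp add: bij_def surj_image_vimage_eq)
        then show ?thesis using iff that by (metis imageI)
      qed
      then show "(`) \<pi> ` met u\<^sub>1 = met u\<^sub>2" using iff by auto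
    qed
    moreover have "\<forall>S\<in>met u\<^sub>1. \<forall>T\<in>met u\<^sub>1. S \<subseteq> T \<longleftrightarrow> \<pi> ` S \<subseteq> \<pi> ` T"
      using \<open>bij \<pi>\<close> by (simp add: bij_def inj_image_subset_iff)
    ultimately show "\<exists>g. bij_betw g (met u\<^sub>1) (met u\<^sub>2) \<and>
        (\<forall>S\<in>met u\<^sub>1. \<forall>T\<in>met u\<^sub>1. S \<subseteq> T \<longleftrightarrow> g S \<subseteq> g T)"
      by (intro exI[of _ "(`) \<pi>"]) simp
  qed
qed

end
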